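(* Let $q\ge 2$ be an integer and let $f$ be a $q$-regular sequence with a zero-insensitive linear representation $(\mathbf{u},(M_i)_{0\le i<q},\mathbf{v})$, so that $f(n)=\mathbf{u}^t M_{n_0}M_{n_1}\cdots M_{n_L}\mathbf{v}$ where $n_L\cdots n_0$ is the $q$-ary expansion of $n$. Let $U$ be the smallest vector space such that every vector of the form $\mathbf{u}^t M_{d_1}M_{d_2}\cdots M_{d_m}$ (for any $m\ge 0$ and any digits $d_1,\dots,d_m\in\{0,\dots,q-1\}$) lies in the affine subspace $\mathbf{u}^t+U^t$, where $U^t=\{\mathbf{x}^t:\mathbf{x}\in U\}$. Let $V$ be the smallest vector space such that every vector of the form $M_{d_1}M_{d_2}\cdots M_{d_m}\mathbf{v}$ (for any $m\ge0$ and digits $d_j\in\{0,\dots,q-1\}$) lies in $\mathbf{v}+V$. Let $r$ be a nonnegative integer. Then $f$ is $q$-quasiadditive with parameter $r$, i.e. $f(q^{k+r}a+b)=f(a)+f(b)$ for all nonnegative integers $a,b,k$ with $0\le b<q^k$, if and only if all of the following hold: (1) $\mathbf{u}^t\mathbf{v}=0$; (2) $\mathbf{x}^t(M_0^r-I)\mathbf{v}=0$ for all $\mathbf{x}\in U$; (3) $\mathbf{u}^t(M_0^r-I)\mathbf{y}=0$ for all $\mathbf{y}\in V$; (4) $\mathbf{x}^tM_0^r\mathbf{y}=0$ for all $\mathbf{x}\in U$ and $\mathbf{y}\in V$.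
   Context: A function $f$ on the nonnegative integers is $q$-regular if there exist a vector $\mathbf{u}$, a vector-valued function $\mathbf{f}$ and square matrices $M_0,\dots,M_{q-1}$ such that $f=\mathbf{u}^t\mathbf{f}$ and $\mathbf{f}(qn+i)=M_i\mathbf{f}(n)$ for all $0\le i<q$ and all $n$ with $qn+i>0$; one sets $\mathbf{v}=\mathbf{f}(0)$. Equivalently $f(n)=\mathbf{u}^t M_{n_0}M_{n_1}\cdots M_{n_L}\mathbf{v}$ with $n_L\cdots n_0$ the $q$-ary expansion of $n$. The triple $(\mathbf{u},(M_i),\mathbf{v})$ is a linear representation of $f$; it is zero-insensitive if $M_0\mathbf{v}=\mathbf{v}$. $I$ denotes the identity matrix. *)

theory Defs
  imports "HOL-Analysis.Analysis"
begin

text \<open>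
  A linear representation of \<open>f\<close> over an arbitrary field \<open>'a\<close>; only the matrices
  \<open>M i\<close> with \<open>i < q\<close> are relevant. The function \<open>F\<close> is the vector-valued function
  whose first value is \<open>v\<close>. Note that the recursion is not required at \<open>q * n + i = 0\<close>.
\<close>

definition linear_representation ::
  "nat \<Rightarrow> (nat \<Rightarrow> 'a::field) \<Rightarrow> 'a^'n \<Rightarrow> (nat \<Rightarrow> 'a^'n^'n) \<Rightarrow> 'a^'n \<Rightarrow> bool" where
  "linear_representation q f u M v \<longleftrightarrow>
     (\<exists>F. (\<forall>n. f n = scalar_product u (F n)) \<and>
          (\<forall>n i. i < q \<and> q * n + i > 0 \<longrightarrow> F (q * n + i) = M i *v F n) \<and>
          F 0 = v)"

definition zero_insensitive :: "(nat \<Rightarrow> 'a::field^'n^'n) \<Rightarrow> 'a^'n \<Rightarrow> bool" where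
  "zero_insensitive M v \<longleftrightarrow> M 0 *v v = v"

text \<open>The product \<open>M d\<^sub>1 ** M d\<^sub>2 ** \<dots> ** M d\<^sub>m\<close> for the list \<open>[d\<^sub>1, \<dots>, d\<^sub>m]\<close>.\<close>

fun digit_product :: "(nat \<Rightarrow> 'a::field^'n^'n) \<Rightarrow> nat list \<Rightarrow> 'a^'n^'n" where
  "digit_product M [] = mat 1"
| "digit_product M (d # ds) = M d ** digit_product M ds"

fun matrix_power :: "'a::field^'n^'n \<Rightarrow> nat \<Rightarrow> 'a^'n^'n" where
  "matrix_power A 0 = mat 1"
| "matrix_power A (Suc k) = A ** matrix_power A k"

text \<open>The formula for \<open>f n\<close> in terms of the \<open>q\<close>-ary digits of \<open>n\<close>, least significant digit first.\<close>

lemma linear_representation_digits: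
  assumes "linear_representation q f u M v" and "zero_insensitive M v" and "set ds \<subseteq> {..<q}"
  shows "f (horner_sum id q ds) = scalar_product u (digit_product M ds *v v)"
proof -
  obtain F where F: "\<And>n. f n = scalar_product u (F n)" "F 0 = v"
      "\<And>n i. i < q \<Longrightarrow> q * n + i > 0 \<Longrightarrow> F (q * n + i) = M i *v F n"
    using assms(1) unfolding linear_representation_def by blast
  have rec: "F (q * n + i) = M i *v F n" if "i < q" for n i
    using F(2) F(3)[of i n] assms(2) that
    by (cases "q * n + i > 0") (auto simp: zero_insensitive_def)
  have "F (horner_sum id q ds) = digit_product M ds *v v"
    using assms(3)
  proof (induction ds)
    case Nil
    then show ?case by (simp add: F(2))
  next
    case (Cons d ds)
    then show ?case
      using rec[of d "horner_sum id q ds"]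
      by (simp add: id_def add.commute flip: matrix_vector_mul_assoc)
  qed
  then show ?thesis by (simp add: F(1))
qed

text \<open>The smallest linear subspace \<open>W\<close> such that the affine subspace \<open>p + W\<close> contains \<open>S\<close>.\<close>

definition smallest_direction :: "'a::field^'n \<Rightarrow> ('a^'n) set \<Rightarrow> ('a^'n) set" where
  "smallest_direction p S = \<Inter>{W. vec.subspace W \<and> S \<subseteq> (\<lambda>w. p + w) ` W}"

lemma smallest_direction:
  shows "vec.subspace (smallest_direction p S)"
    and "S \<subseteq> (\<lambda>w. p + w) ` smallest_direction p S"
    and "\<And>W. vec.subspace W \<Longrightarrow> S \<subseteq> (\<lambda>w. p + w) ` W \<Longrightarrow> smallest_direction p S \<subseteq> W"
proof -
  show "vec.subspace (smallest_direction p S)"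
    unfolding smallest_direction_def by (rule vec.subspace_Inter) auto
  show "S \<subseteq> (\<lambda>w. p + w) ` smallest_direction p S"
  proof
    fix s assume s: "s \<in> S"
    have "s - p \<in> smallest_direction p S"
      using s unfolding smallest_direction_def by fastforce
    then show "s \<in> (\<lambda>w. p + w) ` smallest_direction p S"
      by (intro image_eqI[of _ _ "s - p"]) auto
  qed
  show "smallest_direction p S \<subseteq> W" if "vec.subspace W" "S \<subseteq> (\<lambda>w. p + w) ` W" for W
    using that unfolding smallest_direction_def by blast
qed

definition left_space :: "nat \<Rightarrow> 'a::field^'n \<Rightarrow> (nat \<Rightarrow> 'a^'n^'n) \<Rightarrow> ('a^'n) set" where
  "left_space q u M = smallest_direction u {u v* digit_product M ds |ds. set ds \<subseteq> {..<q}}"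

definition right_space :: "nat \<Rightarrow> (nat \<Rightarrow> 'a::field^'n^'n) \<Rightarrow> 'a^'n \<Rightarrow> ('a^'n) set" where
  "right_space q M v = smallest_direction v {digit_product M ds *v v |ds. set ds \<subseteq> {..<q}}"

definition quasiadditive :: "nat \<Rightarrow> nat \<Rightarrow> (nat \<Rightarrow> 'a::field) \<Rightarrow> bool" where
  "quasiadditive q r f \<longleftrightarrow>
     (\<forall>a b k. b < q ^ k \<longrightarrow> f (q ^ (k + r) * a + b) = f a + f b)"

end

theory Submission
  imports Defs
begin

text \<open>
  Padding the digit word of \<open>b\<close> with zeros to length \<open>k\<close> is harmless by zero-insensitivity, so
  quasiadditivity says that \<open>u\<^sup>t P M\<^sub>0\<^sup>r Q v = u\<^sup>t Q v + u\<^sup>t P v\<close> for all digit products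
  \<open>P\<close> and \<open>Q\<close>. Writing \<open>u\<^sup>t P = u\<^sup>t + x\<^sup>t\<close> and \<open>Q v = v + y\<close> and using
  \<open>M\<^sub>0\<^sup>r v = v\<close>, this becomes \<open>u\<^sup>t (M\<^sub>0\<^sup>r - I) y + x\<^sup>t M\<^sub>0\<^sup>r y = u\<^sup>t v\<close>. Taking empty words
  separates the three terms, and the resulting conditions are linear in \<open>x\<close> and \<open>y\<close>, hence
  extend to \<open>U\<close> and \<open>V\<close>. Condition (2) holds automatically, since \<open>M\<^sub>0\<^sup>r v = v\<close>.
\<close>

lemma scalar_product_add_left:
  "scalar_product (x + y) z = scalar_product x z + scalar_product y z"
  for x y z :: "'a::comm_semiring_1^'n"
  by (simp add: scalar_product_def distrib_right sum.distrib)

lemma scalar_product_add_right: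
  "scalar_product x (y + z) = scalar_product x y + scalar_product x z"
  for x y z :: "'a::comm_semiring_1^'n"
  by (simp add: scalar_product_def distrib_left sum.distrib)

lemma scalar_product_diff_right:
  "scalar_product x (y - z) = scalar_product x y - scalar_product x z"
  for x y z :: "'a::comm_ring_1^'n"
  by (simp add: scalar_product_def right_diff_distrib sum_subtractf)

lemma scalar_product_scale_left: "scalar_product (c *s x) y = c * scalar_product x y"
  for x y :: "'a::comm_semiring_1^'n"
  by (simp add: scalar_product_def sum_distrib_left mult.assoc)

lemma scalar_product_scale_right: "scalar_product x (c *s y) = c * scalar_product x y"
  for x y :: "'a::comm_semiring_1^'n"
  by (simp add: scalar_product_def sum_distrib_left mult.left_commute)

lemma scalar_product_zero [simp]:
  "scalar_product 0 y = 0" "scalar_product x 0 = 0"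
  by (simp_all add: scalar_product_def)

lemma scalar_product_vector_matrix_mult:
  "scalar_product (x v* A) y = scalar_product x (A *v y)"
  for x :: "'a::comm_semiring_1^'m" and y :: "'a^'n" and A :: "'a^'n^'m"
proof -
  have "scalar_product (x v* A) y = (\<Sum>j\<in>UNIV. \<Sum>i\<in>UNIV. x $ i * (A $ i $ j * y $ j))"
    by (simp add: scalar_product_def vector_matrix_mult_def sum_distrib_left sum_distrib_right mult_ac)
  also have "\<dots> = (\<Sum>i\<in>UNIV. \<Sum>j\<in>UNIV. x $ i * (A $ i $ j * y $ j))"
    by (rule sum.swap)
  also have "\<dots> = scalar_product x (A *v y)"
    by (simp add: scalar_product_def matrix_vector_mult_def sum_distrib_left)
  finally show ?thesis .
qed

lemma digit_product_append:
  "digit_product M (ds @ es) = digit_product M ds ** digit_product M es"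
  by (induction ds) (simp_all add: matrix_mul_assoc)

lemma digit_product_replicate: "digit_product M (replicate k d) = matrix_power (M d) k"
  by (induction k) simp_all

lemma matrix_power_fixed: "A *v x = x \<Longrightarrow> matrix_power A k *v x = x"
  by (induction k) (simp_all flip: matrix_vector_mul_assoc)

lemma horner_sum_less_power:
  "set ds \<subseteq> {..<q} \<Longrightarrow> horner_sum id q ds < q ^ length ds" for q :: nat
proof (induction ds)
  case (Cons d ds)
  \<comment> \<open>The extra \<open>q\<close> on both sides lets \<open>d < q\<close> combine with
    \<open>horner_sum id q ds + 1 \<le> q ^ length ds\<close> without subtraction; cancelling it
    gives the goal.\<close>
  then have "d + q * (horner_sum id q ds + 1) < q + q * q ^ length ds"
    by (intro add_less_le_mono mult_le_mono2) (auto simp: id_def Suc_le_eq)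
  then show ?case by (simp add: id_def)
qed simp

text \<open>The length is prescribed and leading zeros are allowed, because \<open>b\<close> has to
  fill the low block of exactly \<open>k\<close> digits in \<open>q ^ (k + r) * a + b\<close>. The
  induction peels off the least significant digit.\<close>

lemma horner_sum_digits_exist:
  fixes q b k :: nat
  assumes "b < q ^ k"
  obtains ds where "set ds \<subseteq> {..<q}" "length ds = k" "horner_sum id q ds = b"
  using assms
proof (induction k arbitrary: b thesis)
  case 0
  then show ?case by auto
next
  case (Suc k)
  have "q > 0" using Suc.prems(2) by (cases "q = 0") auto
  moreover have "b div q < q ^ k"
    using Suc.prems(2) by (simp add: less_mult_imp_div_less mult.commute)
  then obtain ds where "set ds \<subseteq> {..<q}" "length ds = k" "horner_sum id q ds = b div q"
    using Suc.IH by blast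
  ultimately show ?case
    by (intro Suc.prems(1)[of "b mod q # ds"]) (auto simp: id_def)
qed

text \<open>Reduces a linear condition on \<open>U\<close> or \<open>V\<close> to the generating
  displacements \<open>s - p\<close>: \<open>W\<close> will be the kernel of a linear
  functional.\<close>

lemma smallest_direction_iff:
  assumes "vec.subspace W"
  shows "smallest_direction p S \<subseteq> W \<longleftrightarrow> (\<forall>s\<in>S. s - p \<in> W)"
proof
  assume "smallest_direction p S \<subseteq> W"
  then show "\<forall>s\<in>S. s - p \<in> W" using smallest_direction(2)[of S p] by fastforce
next
  assume "\<forall>s\<in>S. s - p \<in> W"
  then have "S \<subseteq> (\<lambda>w. p + w) ` W"
    by (metis (no_types, lifting) add.commute diff_add_cancel image_iff subsetI)
  then show "smallest_direction p S \<subseteq> W" by (rule smallest_direction(3)[OF assms])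
qed

lemma subspace_scalar_product_left:
  "vec.subspace {x. scalar_product x w = 0}" for w :: "'a::field^'n"
  by (auto simp: vec.subspace_def scalar_product_add_left scalar_product_scale_left)

lemma subspace_scalar_product_right:
  "vec.subspace {y. scalar_product w (A *v y) = 0}" for w :: "'a::field^'n"
  by (auto simp: vec.subspace_def scalar_product_add_right scalar_product_scale_right
      matrix_vector_right_distrib vec.scale)

text \<open>Any \<open>b < q ^ k\<close> comes from a word \<open>ds\<close> of length
  \<open>k\<close>, and any \<open>a\<close> from some word \<open>es\<close>, so quantifying over
  words covers all \<open>a\<close>, \<open>b\<close>, \<open>k\<close>.\<close>

lemma quasiadditive_iff_digit_product:
  fixes f :: "nat \<Rightarrow> 'a::field" and u v :: "'a^'n"
  assumes "q \<ge> 2" "linear_representation q f u M v" "zero_insensitive M v"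
  shows "quasiadditive q r f \<longleftrightarrow>
    (\<forall>ds es. set ds \<subseteq> {..<q} \<longrightarrow> set es \<subseteq> {..<q} \<longrightarrow>
       scalar_product (u v* digit_product M ds) (matrix_power (M 0) r *v (digit_product M es *v v)) =
       scalar_product u (digit_product M es *v v) + scalar_product (u v* digit_product M ds) v)"
    (is "_ \<longleftrightarrow> ?R")
proof -
  let ?h = "horner_sum id q"
  note digits = linear_representation_digits[OF assms(2,3)]
  \<comment> \<open>With the least significant digit first, the argument has the digit word
    \<open>ds\<close>, then \<open>r\<close> zeros, then \<open>es\<close>; the zeros contribute
    \<open>matrix_power (M 0) r\<close>.\<close>
  have rec: "f (q ^ (length ds + r) * ?h es + ?h ds) =
      scalar_product (u v* digit_product M ds) (matrix_power (M 0) r *v (digit_product M es *v v))"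
    if "set ds \<subseteq> {..<q}" "set es \<subseteq> {..<q}" for ds es
  proof -
    have "?h (replicate r 0 @ es) = q ^ r * ?h es"
      by (induction r) simp_all
    then have "?h (ds @ replicate r 0 @ es) = q ^ (length ds + r) * ?h es + ?h ds"
      by (simp add: horner_sum_append power_add mult.assoc)
    moreover have "set (ds @ replicate r 0 @ es) \<subseteq> {..<q}"
      using that assms(1) by auto
    ultimately show ?thesis
      using digits[of "ds @ replicate r 0 @ es"]
      by (simp add: digit_product_append digit_product_replicate scalar_product_vector_matrix_mult
          matrix_vector_mul_assoc matrix_mul_assoc)
  qed
  show ?thesis
  proof
    assume quasi: "quasiadditive q r f"
    show ?R
    proof (intro allI impI)
      fix ds es
      assume "set ds \<subseteq> {..<q}" "set es \<subseteq> {..<q}"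
      then show "scalar_product (u v* digit_product M ds)
            (matrix_power (M 0) r *v (digit_product M es *v v)) =
          scalar_product u (digit_product M es *v v) + scalar_product (u v* digit_product M ds) v"
        using quasi[unfolded quasiadditive_def, rule_format, OF horner_sum_less_power[of ds q], of "?h es"]
          rec[of ds es] digits[of ds] digits[of es]
        by (simp add: scalar_product_vector_matrix_mult)
    qed
  next
    assume R: ?R
    show "quasiadditive q r f"
      unfolding quasiadditive_def
    proof (intro allI impI)
      fix a b k
      assume "b < q ^ k"
      then obtain ds where ds: "set ds \<subseteq> {..<q}" "length ds = k" "?h ds = b"
        by (rule horner_sum_digits_exist)
      \<comment> \<open>The number of digits for \<open>a\<close> is arbitrary, so the crude bound
        \<open>a\<close> suffices.\<close>
      have "a < q ^ a" using assms(1) by (simp add: less_exp power_gt_expt)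
      then obtain es where es: "set es \<subseteq> {..<q}" "?h es = a"
        by (rule horner_sum_digits_exist)
      show "f (q ^ (k + r) * a + b) = f a + f b"
        using rec[OF ds(1) es(1)] R ds es digits[OF ds(1)] digits[OF es(1)]
        by (simp add: scalar_product_vector_matrix_mult)
    qed
  qed
qed

theorem mainTheorem2:
  fixes q r :: nat
    and f :: "nat \<Rightarrow> 'a::field"
    and u v :: "'a^'n"
    and M :: "nat \<Rightarrow> 'a^'n^'n"
    and U V :: "('a^'n) set"
  assumes "q \<ge> 2"
    and "linear_representation q f u M v"
    and "zero_insensitive M v"
    and "U = left_space q u M"
    and "V = right_space q M v"
  shows "quasiadditive q r f \<longleftrightarrow>
      scalar_product u v = 0 \<and>
      (\<forall>x\<in>U. scalar_product x ((matrix_power (M 0) r - mat 1) *v v) = 0) \<and>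
      (\<forall>y\<in>V. scalar_product u ((matrix_power (M 0) r - mat 1) *v y) = 0) \<and>
      (\<forall>x\<in>U. \<forall>y\<in>V. scalar_product x (matrix_power (M 0) r *v y) = 0)"
proof -
  let ?N = "matrix_power (M 0) r"
  define D where "D = {ds. set ds \<subseteq> {..<q}}"
  define X where "X ds = u v* digit_product M ds - u" for ds
  define Y where "Y es = digit_product M es *v v - v" for es
  have Nv: "?N *v v = v"
    using assms(3) by (simp add: zero_insensitive_def matrix_power_fixed)
  have U: "U \<subseteq> W \<longleftrightarrow> (\<forall>ds\<in>D. X ds \<in> W)" if "vec.subspace W" for W
    unfolding assms(4) left_space_def smallest_direction_iff[OF that] D_def X_def by blast
  have V: "V \<subseteq> W \<longleftrightarrow> (\<forall>es\<in>D. Y es \<in> W)" if "vec.subspace W" for W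
    unfolding assms(5) right_space_def smallest_direction_iff[OF that] D_def Y_def by blast
  have c2: "\<forall>x\<in>U. scalar_product x ((?N - mat 1) *v v) = 0"
    by (simp add: matrix_vector_mult_diff_rdistrib Nv)
  have c3: "(\<forall>y\<in>V. scalar_product u ((?N - mat 1) *v y) = 0) \<longleftrightarrow>
      (\<forall>es\<in>D. scalar_product u ((?N - mat 1) *v Y es) = 0)"
    using V[OF subspace_scalar_product_right[of u "?N - mat 1"]] by blast
  have c4: "(\<forall>x\<in>U. \<forall>y\<in>V. scalar_product x (?N *v y) = 0) \<longleftrightarrow>
      (\<forall>ds\<in>D. \<forall>es\<in>D. scalar_product (X ds) (?N *v Y es) = 0)"
  proof -
    \<comment> \<open>The pairing is linear in each argument separately: first \<open>y\<close> is
      reduced to generators for fixed \<open>x\<close>, then \<open>x\<close> for fixed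
      \<open>Y es\<close>.\<close>
    have "(\<forall>x\<in>U. \<forall>y\<in>V. scalar_product x (?N *v y) = 0) \<longleftrightarrow>
        (\<forall>x\<in>U. \<forall>es\<in>D. scalar_product x (?N *v Y es) = 0)"
      using V[OF subspace_scalar_product_right[of _ "?N"]] by blast
    also have "\<dots> \<longleftrightarrow> (\<forall>ds\<in>D. \<forall>es\<in>D. scalar_product (X ds) (?N *v Y es) = 0)"
      using U[OF subspace_scalar_product_left] by blast
    finally show ?thesis .
  qed
  \<comment> \<open>Expand bilinearly at \<open>u + X ds\<close> and \<open>v + Y es\<close>. As
    \<open>?N\<close> fixes \<open>v\<close>, the terms pairing \<open>X ds\<close> with
    \<open>v\<close> cancel, as does one copy of \<open>scalar_product u v\<close>.\<close>
  have expand: "scalar_product (u v* digit_product M ds) (?N *v (digit_product M es *v v)) =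
        scalar_product u (digit_product M es *v v) + scalar_product (u v* digit_product M ds) v
      \<longleftrightarrow> scalar_product u ((?N - mat 1) *v Y es) + scalar_product (X ds) (?N *v Y es)
        = scalar_product u v" for ds es
  proof -
    have "u v* digit_product M ds = u + X ds" "digit_product M es *v v = v + Y es"
      by (simp_all add: X_def Y_def)
    then show ?thesis
      by (auto simp: matrix_vector_right_distrib matrix_vector_mult_diff_rdistrib Nv
          scalar_product_add_left scalar_product_add_right scalar_product_diff_right algebra_simps)
  qed
  have nil: "[] \<in> D" "X [] = 0" "Y [] = 0"
    by (simp_all add: D_def X_def Y_def)
  have "quasiadditive q r f \<longleftrightarrow> (\<forall>ds\<in>D. \<forall>es\<in>D.
      scalar_product u ((?N - mat 1) *v Y es) + scalar_product (X ds) (?N *v Y es)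
        = scalar_product u v)"
    unfolding quasiadditive_iff_digit_product[OF assms(1-3)] expand D_def by blast
  also have "\<dots> \<longleftrightarrow> scalar_product u v = 0 \<and>
      (\<forall>es\<in>D. scalar_product u ((?N - mat 1) *v Y es) = 0) \<and>
      (\<forall>ds\<in>D. \<forall>es\<in>D. scalar_product (X ds) (?N *v Y es) = 0)"
    (is "?L \<longleftrightarrow> ?R")
  proof
    assume L: ?L
    \<comment> \<open>Two empty words make both displacements vanish, leaving the constant
      term.\<close>
    have 1: "scalar_product u v = 0"
      using L[rule_format, OF nil(1) nil(1)] by (simp add: nil)
    \<comment> \<open>An empty \<open>ds\<close> alone removes the mixed term and isolates condition
      (3); what then remains of \<open>L\<close> is condition (4).\<close>
    have 2: "scalar_product u ((?N - mat 1) *v Y es) = 0" if "es \<in> D" for es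
      using L[rule_format, OF nil(1) that] 1 by (simp add: nil)
    show ?R using L 1 2 by simp
  qed simp
  finally show ?thesis using c2 c3 c4 by simp
qed

end
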